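(* Let $k$ and $\Delta$ be positive integers and let $\mathcal{H}$ be an intersecting $k$-graph with maximum degree at most $\Delta$. Then \[ \mathrm{Ord}(\mathcal{H})\leq \frac{1}{4}k^2\Delta + \frac{3}{2}\binom{2k-2}{k-1}. \] Moreover, this bound is asymptotically tight for large $\Delta$.
   Context: A $k$-graph is a $k$-uniform hypergraph (every edge is a set of exactly $k$ vertices). A hypergraph is intersecting if every pair of distinct edges shares at least one vertex. The degree of a vertex is the number of edges containing it. The order $\mathrm{Ord}(\mathcal{H})$ of a hypergraph $\mathcal{H}$ is the number of non-isolated vertices of $\mathcal{H}$, i.e. the number of vertices lying in at least one edge.
   Formalization: "Asymptotically tight for large Δ" is taken as: for every ε > 0, all large k, and all Δ large in terms of k, some example has order at least (1−ε) times the bound; for fixed k the claim fails, e.g. for k = 1 the order is at most 1 while the bound grows with Δ. *)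

theory Defs
  imports Complex_Main
begin

text \<open>A hypergraph is given by its vertex set \<open>V\<close> and its set of edges \<open>E\<close>. Neither is required to be
  finite, so bounds on cardinalities are stated together with finiteness (\<open>card\<close> is \<open>0\<close> on infinite
  sets).\<close>

definition k_graph :: "nat \<Rightarrow> 'a set \<Rightarrow> 'a set set \<Rightarrow> bool" where
  "k_graph k V E \<longleftrightarrow> (\<forall>e\<in>E. e \<subseteq> V \<and> finite e \<and> card e = k)"

definition intersecting :: "'a set set \<Rightarrow> bool" where
  "intersecting E \<longleftrightarrow> (\<forall>e\<in>E. \<forall>f\<in>E. e \<noteq> f \<longrightarrow> e \<inter> f \<noteq> {})"

definition incident_edges :: "'a set set \<Rightarrow> 'a \<Rightarrow> 'a set set" where
  "incident_edges E v = {e \<in> E. v \<in> e}"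

definition degree :: "'a set set \<Rightarrow> 'a \<Rightarrow> nat" where
  "degree E v = card (incident_edges E v)"

definition max_degree_at_most :: "'a set \<Rightarrow> 'a set set \<Rightarrow> nat \<Rightarrow> bool" where
  "max_degree_at_most V E \<Delta> \<longleftrightarrow> (\<forall>v\<in>V. finite (incident_edges E v) \<and> degree E v \<le> \<Delta>)"

definition non_isolated :: "'a set \<Rightarrow> 'a set set \<Rightarrow> 'a set" where
  "non_isolated V E = {v \<in> V. \<exists>e\<in>E. v \<in> e}"

definition Ord :: "'a set \<Rightarrow> 'a set set \<Rightarrow> nat" where
  "Ord V E = card (non_isolated V E)"

end

theory Submission
  imports
    Defs
    "HOL-Library.Countable"
    "HOL-Computational_Algebra.Primes"
    "HOL-Number_Theory.Cong"
    "HOL-Analysis.Kronecker_Approximation_Theorem"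
begin

text \<open>Upper bound. Let \<open>m\<close> be the number of edges and \<open>n\<close> the order. The degrees \<open>d\<close> of the non-isolated
  vertices sum to \<open>m k\<close>, and since all edges meet each other their squares sum to at least
  \<open>m (m + k - 1)\<close>. As \<open>1 \<le> d \<le> \<Delta>\<close>, summing \<open>(\<Delta> - d) (d - 1) \<ge> 0\<close> gives \<open>n \<Delta> \<le> m (k \<Delta> + 1 - m)\<close>, hence
  \<open>n \<le> k\<^sup>2 \<Delta> / 4 + k / 2 + 1 / 4\<close>.

  Tightness. Take an intersecting family of about \<open>n\<^sup>2\<close> sets of size about \<open>n \<approx> k / 2\<close> in which every
  point has degree at most \<open>n\<close>, replace each set by \<open>\<Delta> / n\<close> copies, and pad every copy with about
  \<open>k / 2\<close> private vertices. A projective plane of order near \<open>k / 2\<close> would serve as the family, but for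
  all large \<open>k\<close> that requires short gaps between prime powers. Instead we use lines over \<open>\<int>/p\<^sup>i\<close>, which intersect
  because of two elements of this ring one divides the other, and take products of these families for two
  large fixed primes \<open>p\<close> and \<open>q\<close>: the numbers \<open>p\<^sup>i q\<^sup>j\<close> are eventually dense on the logarithmic scale.\<close>

section \<open>The upper bound\<close>

text \<open>An edge is nonempty because \<open>k > 0\<close>, and every edge meets it, so all edges
  lie in finitely many finite incidence sets.\<close>

lemma intersecting_k_graph_finite:
  assumes "k > 0" "k_graph k V E" "intersecting E" "max_degree_at_most V E \<Delta>"
  shows "finite E"
proof (cases "E = {}")
  case False
  then obtain e where e: "e \<in> E" by blast
  have fin: "finite e" "e \<subseteq> V" "e \<noteq> {}"
    using assms(1,2) e by (auto simp: k_graph_def)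
  have "E \<subseteq> (\<Union>v\<in>e. incident_edges E v)"
  proof
    fix f assume f: "f \<in> E"
    then have "e \<inter> f \<noteq> {}" using assms(3) e fin(3) by (cases "e = f") (auto simp: intersecting_def)
    then show "f \<in> (\<Union>v\<in>e. incident_edges E v)" using f by (auto simp: incident_edges_def)
  qed
  moreover have "finite (\<Union>v\<in>e. incident_edges E v)"
    using assms(4) fin by (auto simp: max_degree_at_most_def)
  ultimately show ?thesis by (rule finite_subset)
qed simp

text \<open>Count the pairs \<open>(v, f)\<close> with \<open>v\<close> in both \<open>e\<close> and
  \<open>f\<close>: the edge \<open>f = e\<close> contributes \<open>k\<close>, every other edge at
  least 1. The \<open>+ 1\<close> on the left avoids truncated subtraction.\<close>

lemma sum_degree_edge_ge:
  assumes "finite E" "k_graph k V E" "intersecting E" "e \<in> E"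
  shows "(\<Sum>v\<in>e. degree E v) + 1 \<ge> card E + k"
proof -
  have fe: "finite e" "card e = k" using assms(2,4) by (auto simp: k_graph_def)
  have "(\<Sum>v\<in>e. degree E v) = (\<Sum>v\<in>e. \<Sum>f | f \<in> E \<and> v \<in> f. 1)"
    by (simp add: degree_def incident_edges_def)
  also have "\<dots> = (\<Sum>f\<in>E. \<Sum>v | v \<in> e \<and> v \<in> f. 1)"
    by (rule sum.swap_restrict) (use assms fe in auto)
  also have "\<dots> = (\<Sum>f\<in>E. card (e \<inter> f))"
    by (simp add: Int_def)
  also have "\<dots> = k + (\<Sum>f\<in>E - {e}. card (e \<inter> f))"
    using assms fe by (subst sum.remove[of E e]) auto
  finally have eq: "(\<Sum>v\<in>e. degree E v) = k + (\<Sum>f\<in>E - {e}. card (e \<inter> f))" .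
  have "(\<Sum>f\<in>E - {e}. 1) \<le> (\<Sum>f\<in>E - {e}. card (e \<inter> f))"
  proof (rule sum_mono)
    fix f assume "f \<in> E - {e}"
    then have "e \<inter> f \<noteq> {}" using assms(3,4) by (auto simp: intersecting_def)
    then show "1 \<le> card (e \<inter> f)" using fe by (simp add: Suc_le_eq card_gt_0_iff)
  qed
  then have "(\<Sum>v\<in>e. degree E v) \<ge> k + card (E - {e})" using eq by simp
  then show ?thesis using assms(1,4) by (simp add: card_Diff_singleton_if)
qed

text \<open>Serves to absorb the terms \<open>k / 2 + 1/4\<close> of the upper bound into the
  binomial term.\<close>

lemma central_binomial_ge:
  assumes "k > 0"
  shows "k \<le> (2 * k - 2) choose (k - 1)"
proof (cases "k \<le> 2")
  case True
  then have "k = 1 \<or> k = 2" using assms by auto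
  then show ?thesis by auto
next
  case False
  then have "(2 * k - 2) choose 1 \<le> (2 * k - 2) choose (k - 1)"
    by (intro binomial_mono) auto
  then show ?thesis using False by simp
qed

lemma Ord_upper_bound:
  assumes "k > 0" "\<Delta> > 0" "k_graph k V E" "intersecting E" "max_degree_at_most V E \<Delta>"
  shows "finite (non_isolated V E)"
    and "real (Ord V E) \<le> 1/4 * real k ^ 2 * real \<Delta> + real k / 2 + 1/4"
proof -
  define W where "W = non_isolated V E"
  have finE: "finite E" using intersecting_k_graph_finite assms by blast
  have W_eq: "W = \<Union>E"
    using assms(3) by (auto simp: W_def non_isolated_def k_graph_def)
  show finW: "finite (non_isolated V E)"
    using finE assms(3) unfolding W_def[symmetric] W_eq by (auto simp: k_graph_def)
  define m where "m = real (card E)"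
  define d where "d v = real (degree E v)" for v
  \<comment> \<open>Weighted double counting: \<open>g = 1\<close> gives the degree sum,
    \<open>g = d\<close> the sum of squares.\<close>
  have swap: "(\<Sum>v\<in>W. d v * g v) = (\<Sum>e\<in>E. \<Sum>v\<in>e. g v)" for g :: "'a \<Rightarrow> real"
  proof -
    have "(\<Sum>v\<in>W. d v * g v) = (\<Sum>v\<in>W. \<Sum>e | e \<in> E \<and> v \<in> e. g v)"
      by (simp add: d_def degree_def incident_edges_def)
    also have "\<dots> = (\<Sum>e\<in>E. \<Sum>v | v \<in> W \<and> v \<in> e. g v)"
      by (rule sum.swap_restrict) (use finE finW W_def in auto)
    also have "\<dots> = (\<Sum>e\<in>E. \<Sum>v\<in>e. g v)"
      by (intro sum.cong refl) (auto simp: W_eq)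
    finally show ?thesis .
  qed
  have s1: "(\<Sum>v\<in>W. d v) = m * k"
    using swap[of "\<lambda>_. 1"] assms(3) by (simp add: m_def k_graph_def)
  have s2: "(\<Sum>v\<in>W. d v * d v) \<ge> m * (m + k - 1)"
  proof -
    have "m + k - 1 \<le> (\<Sum>v\<in>e. d v)" if "e \<in> E" for e
    proof -
      have "real (card E + k) \<le> real ((\<Sum>v\<in>e. degree E v) + 1)"
        using sum_degree_edge_ge[OF finE assms(3,4) that] by (rule of_nat_mono)
      then show ?thesis by (simp add: m_def d_def)
    qed
    then have "(\<Sum>e\<in>E. m + k - 1) \<le> (\<Sum>e\<in>E. \<Sum>v\<in>e. d v)"
      by (intro sum_mono)
    then show ?thesis by (simp add: swap m_def)
  qed
  have "0 \<le> (\<Delta> - d v) * (d v - 1)" if "v \<in> W" for v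
  proof -
    have v: "v \<in> V" "\<exists>e\<in>E. v \<in> e" using that by (auto simp: W_def non_isolated_def)
    have "degree E v \<le> \<Delta>" using v assms(5) by (auto simp: max_degree_at_most_def)
    moreover have "degree E v \<ge> 1"
      using v finE by (auto simp: degree_def incident_edges_def Suc_le_eq card_gt_0_iff)
    ultimately show ?thesis by (simp add: d_def)
  qed
  then have "0 \<le> (\<Sum>v\<in>W. (\<Delta> - d v) * (d v - 1))" by (intro sum_nonneg)
  also have "\<dots> = (\<Delta> + 1) * (\<Sum>v\<in>W. d v) - (\<Sum>v\<in>W. d v * d v) - \<Delta> * card W"
    by (simp add: algebra_simps sum.distrib sum_subtractf sum_distrib_left)
  finally have "\<Delta> * card W \<le> (\<Delta> + 1) * (m * k) - m * (m + k - 1)"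
    using s1 s2 by simp
  also have "\<dots> = m * (k * \<Delta> + 1 - m)" by (simp add: algebra_simps)
  \<comment> \<open>The product is largest at \<open>m = (k * \<Delta> + 1) / 2\<close>.\<close>
  also have "\<dots> \<le> (k * \<Delta> + 1)\<^sup>2 / 4"
  proof -
    have "0 \<le> (2 * m - (k * \<Delta> + 1))\<^sup>2" by simp
    then show ?thesis by (simp add: power2_eq_square algebra_simps)
  qed
  \<comment> \<open>Expanding the square leaves a constant 1/4, which is at most \<Delta> /
    4.\<close>
  also have "\<dots> \<le> \<Delta> * (1/4 * real k ^ 2 * real \<Delta> + real k / 2 + 1/4)"
    using assms(2) by (simp add: power2_eq_square algebra_simps)
  finally have "card W \<le> 1/4 * real k ^ 2 * real \<Delta> + real k / 2 + 1/4"
    using assms(2) unfolding of_nat_mult by (subst (asm) mult_le_cancel_left_pos) auto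
  then show "real (Ord V E) \<le> 1/4 * real k ^ 2 * real \<Delta> + real k / 2 + 1/4"
    by (simp add: Ord_def W_def)
qed

section \<open>Tightness\<close>

text \<open>Divisors of a prime power form a chain. If \<open>gcd \<alpha> n\<close> divides
  \<open>gcd \<beta> n\<close>, the first congruence is solvable. Otherwise the exponent of
  \<open>gcd \<beta> n\<close> is strictly smaller, which leaves room for the extra factor
  \<open>p\<close>; that factor keeps the points at infinity of a line down to
  \<open>n div p\<close>.\<close>

lemma linear_cong_prime_power_chain:
  fixes \<alpha> \<beta> :: int and p i :: nat
  assumes "prime p" and n: "n = int p ^ i"
  shows "(\<exists>x. [\<alpha> * x = \<beta>] (mod n)) \<or> (int p dvd n \<and> (\<exists>z. [\<beta> * (int p * z) = \<alpha>] (mod n)))"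
proof -
  have pr: "prime (int p)" using assms by simp
  obtain a where a: "a \<le> i" "gcd \<alpha> n = int p ^ a"
    using divides_primepow[OF pr, of "gcd \<alpha> n" i] n by auto
  obtain b where b: "b \<le> i" "gcd \<beta> n = int p ^ b"
    using divides_primepow[OF pr, of "gcd \<beta> n" i] n by auto
  show ?thesis
  proof (cases "a \<le> b")
    case True
    then have "gcd \<alpha> n dvd gcd \<beta> n" using a b by (simp add: le_imp_power_dvd)
    then have "gcd \<alpha> n dvd \<beta>" by (rule dvd_trans) simp
    then show ?thesis using cong_solve_dvd_int by blast
  next
    case False
    have "gcd (int p * \<beta>) n dvd gcd (int p * \<beta>) (int p * n)"
      by (rule gcd_mono) auto
    also have "\<dots> = int p ^ Suc b"
      using gcd_mult_distrib_int[of "int p" \<beta> n] b by simp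
    also have "\<dots> dvd gcd \<alpha> n" unfolding a(2) by (rule le_imp_power_dvd) (use False in simp)
    also have "\<dots> dvd \<alpha>" by simp
    finally obtain z where "[int p * \<beta> * z = \<alpha>] (mod n)" using cong_solve_dvd_int by blast
    moreover have "int p dvd n" using False a n by (cases i) auto
    ultimately show ?thesis by (metis mult.assoc mult.commute)
  qed
qed

text \<open>The index set of a line system carries the multiplicities: distinct indices may name the same
  point set.\<close>

definition line_system :: "'l set \<Rightarrow> ('l \<Rightarrow> 'v set) \<Rightarrow> nat \<Rightarrow> nat \<Rightarrow> bool" where
  "line_system L pts r d \<longleftrightarrow> finite L \<and> (\<forall>l\<in>L. finite (pts l) \<and> card (pts l) \<le> r) \<and>
     (\<forall>l\<in>L. \<forall>l'\<in>L. pts l \<inter> pts l' \<noteq> {}) \<and> (\<forall>v. card {l \<in> L. v \<in> pts l} \<le> d)"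

text \<open>Sizes, degrees and numbers of lines all multiply, so having n^2 lines with point degrees
  at most n survives products.\<close>

lemma line_system_product:
  assumes "line_system L pts r d" "line_system L' pts' r' d'"
  shows "line_system (L \<times> L') (\<lambda>(l, l'). pts l \<times> pts' l') (r * r') (d * d')"
  unfolding line_system_def
proof (intro conjI allI ballI)
  show "finite (L \<times> L')" using assms by (simp add: line_system_def)
next
  fix x assume x: "x \<in> L \<times> L'"
  obtain l l' where [simp]: "x = (l, l')" by force
  show "finite (case x of (l, l') \<Rightarrow> pts l \<times> pts' l')"
    "card (case x of (l, l') \<Rightarrow> pts l \<times> pts' l') \<le> r * r'"
    using assms x by (auto simp: line_system_def card_cartesian_product intro: mult_le_mono)
next
  fix x y assume "x \<in> L \<times> L'" "y \<in> L \<times> L'"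
  then show "(case x of (l, l') \<Rightarrow> pts l \<times> pts' l') \<inter> (case y of (l, l') \<Rightarrow> pts l \<times> pts' l') \<noteq> {}"
    using assms by (auto simp: line_system_def Times_Int_Times split: prod.splits)
next
  fix v :: "'b \<times> 'd"
  have "{x \<in> L \<times> L'. v \<in> (case x of (l, l') \<Rightarrow> pts l \<times> pts' l')}
      = {l \<in> L. fst v \<in> pts l} \<times> {l \<in> L'. snd v \<in> pts' l}"
    by (cases v) auto
  then show "card {x \<in> L \<times> L'. v \<in> (case x of (l, l') \<Rightarrow> pts l \<times> pts' l')} \<le> d * d'"
    using assms by (simp add: line_system_def card_cartesian_product mult_le_mono)
qed

text \<open>The line \<open>y = a x + b z\<close> of the projective plane over \<open>\<int>/n\<close>: its points \<open>(x : y : 1)\<close>, and its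
  points \<open>(1 : y : z)\<close> with \<open>p\<close> dividing \<open>z\<close>.\<close>

definition ring_line :: "int \<Rightarrow> int \<Rightarrow> int \<times> int \<Rightarrow> (bool \<times> int \<times> int) set" where
  "ring_line p n = (\<lambda>(a, b). (\<lambda>x. (False, x, (a * x + b) mod n)) ` {0..<n} \<union>
     (\<lambda>z. (True, p * z, (a + b * (p * z)) mod n)) ` {0..<n div p})"

text \<open>Lines \<open>(a, b)\<close> and \<open>(a', b')\<close> share an affine point if
  \<open>(a - a') * x = b' - b\<close> is solvable modulo \<open>n\<close>, and a point at infinity
  if \<open>(b' - b) * (p * z) = a - a'\<close> is. By \<open>linear_cong_prime_power_chain\<close>
  one of the two always is.\<close>

lemma ring_line_system:
  fixes p i :: nat
  assumes p: "prime p"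
  shows "line_system ({0..<int (p ^ i)} \<times> {0..<int (p ^ i)}) (ring_line (int p) (int (p ^ i)))
           (p ^ i + p ^ i div p) (p ^ i)"
proof -
  define n where "n = int (p ^ i)"
  have n: "n > 0" "n = int p ^ i" "nat n = p ^ i"
    using p by (simp_all add: n_def prime_gt_0_nat del: of_nat_power)
  have p0: "int p > 0" using p by (simp add: prime_gt_0_nat)
  have affine: "(False, x, (a * x + b) mod n) \<in> ring_line p n (a, b)" if "x \<in> {0..<n}" for a b x :: int
    using that by (auto simp: ring_line_def)
  have infinite: "(True, int p * z, (a + b * (int p * z)) mod n) \<in> ring_line p n (a, b)"
    if "z \<in> {0..<n div int p}" for a b z :: int
    using that by (auto simp: ring_line_def)
  have meet: "ring_line p n (a, b) \<inter> ring_line p n (a', b') \<noteq> {}" for a b a' b'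
  proof -
    consider x where "[(a - a') * x = b' - b] (mod n)"
      | z where "int p dvd n" "[(b' - b) * (int p * z) = a - a'] (mod n)"
      using linear_cong_prime_power_chain[OF p n(2)] by metis
    then show ?thesis
    proof cases
      case 1
      have "[(a - a') * (x mod n) = b' - b] (mod n)"
        using 1 unfolding Cong.cong_def by (simp only: mod_mult_right_eq)
      then have "[(a - a') * (x mod n) + (a' * (x mod n) + b) = (b' - b) + (a' * (x mod n) + b)] (mod n)"
        by (rule cong_add) simp
      then have eq: "(a * (x mod n) + b) mod n = (a' * (x mod n) + b') mod n"
        by (simp add: Cong.cong_def algebra_simps)
      have x: "x mod n \<in> {0..<n}" using n by simp
      show ?thesis using affine[OF x, of a b] affine[OF x, of a' b'] unfolding eq by blast
    next
      case 2
      \<comment> \<open>Only \<open>p * z\<close> modulo \<open>n\<close> matters, so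
        \<open>z\<close> may be reduced modulo \<open>n div p\<close> into the index range of the
        points at infinity.\<close>
      define w where "w = z mod (n div int p)"
      have nd: "n = int p * (n div int p)" using 2 by simp
      then have ndp: "n div int p > 0" using n p0 by (metis zero_less_mult_pos)
      have "int p * w = (int p * z) mod n"
        using nd by (metis w_def mult_mod_right)
      then have "[(b' - b) * (int p * w) = a - a'] (mod n)"
        using 2 unfolding Cong.cong_def by (simp only: mod_mult_right_eq)
      then have "[(b' - b) * (int p * w) + (a' + b * (int p * w)) = a - a' + (a' + b * (int p * w))] (mod n)"
        by (rule cong_add) simp
      then have eq: "(a + b * (int p * w)) mod n = (a' + b' * (int p * w)) mod n"
        by (simp add: Cong.cong_def algebra_simps)
      have w: "w \<in> {0..<n div int p}" using ndp by (simp add: w_def)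
      show ?thesis using infinite[OF w, of a b] infinite[OF w, of a' b'] unfolding eq by blast
    qed
  qed
  have size: "finite (ring_line p n l)" "card (ring_line p n l) \<le> p ^ i + p ^ i div p" for l
  proof -
    show "finite (ring_line p n l)" by (simp add: ring_line_def split: prod.splits)
    obtain a b where l: "l = (a, b)" by force
    have "card (ring_line p n l) \<le> card {0..<n} + card {0..<n div p}"
      unfolding ring_line_def l prod.case
      by (intro order.trans[OF card_Un_le] add_mono card_image_le) auto
    also have "\<dots> = p ^ i + p ^ i div p" by (simp add: n_def nat_div_distrib nat_power_eq)
    finally show "card (ring_line p n l) \<le> p ^ i + p ^ i div p" .
  qed
  have deg: "card {l \<in> {0..<n} \<times> {0..<n}. v \<in> ring_line p n l} \<le> p ^ i" (is "card ?S \<le> _") for v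
  proof -
    obtain c x y where v: "v = (c, x, y)" by (cases v) auto
    have uniq: "s = t" if "(s + u) mod n = (t + u) mod n" "s \<in> {0..<n}" "t \<in> {0..<n}" for s t u
    proof -
      have "[s = t] (mod n)" using that(1) cong_add_rcancel[of s u t n] by (simp add: Cong.cong_def)
      then show ?thesis using that by (simp add: Cong.cong_def)
    qed
    have eq: "(if c then a + b * x else b + a * x) mod n = y" if "v \<in> ring_line p n (a, b)" for a b
      using that by (auto simp: ring_line_def v add.commute)
    \<comment> \<open>For lines through a fixed affine point \<open>a\<close> determines
      \<open>b\<close>; through a fixed point at infinity \<open>b\<close> determines
      \<open>a\<close>.\<close>
    have "inj_on (if c then snd else fst) ?S"
    proof (rule inj_onI)
      fix l l' assume l: "l \<in> ?S" "l' \<in> ?S"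
        and same: "(if c then snd else fst) l = (if c then snd else fst) l'"
      obtain a b a' b' where ab: "l = (a, b)" "l' = (a', b')" by (meson surj_pair)
      have *: "(if c then a + b * x else b + a * x) mod n = (if c then a' + b' * x else b' + a' * x) mod n"
        using eq l by (simp add: ab)
      show "l = l'"
      proof (cases c)
        case True
        then show ?thesis using uniq[of a "b * x" a'] * same l by (simp add: ab)
      next
        case False
        then show ?thesis using uniq[of b "a * x" b'] * same l by (simp add: ab)
      qed
    qed
    moreover have "(if c then snd else fst) ` ?S \<subseteq> {0..<n}" by auto
    ultimately have "card ?S \<le> card {0..<n}" by (rule card_inj_on_le) simp
    then show ?thesis using n by simp
  qed
  show ?thesis
    using meet size deg unfolding line_system_def n_def[symmetric] by auto
qed

section \<open>From line systems to intersecting hypergraphs\<close>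

text \<open>A shared point lies in at most \<open>d * (\<Delta> div d)\<close> copies, a private
  vertex in only one. \<open>Inl\<close> marks shared points, \<open>Inr\<close> private vertices
  labelled by their copy, and \<open>to_nat\<close> moves both into \<open>nat\<close>.\<close>

lemma blow_up_line_system:
  fixes L :: "'l :: countable set" and pts :: "'l \<Rightarrow> 'v :: countable set"
  assumes ls: "line_system L pts r d" and "r < k" and "d > 0"
  shows "\<exists>(V :: nat set) E. k_graph k V E \<and> intersecting E \<and> max_degree_at_most V E \<Delta> \<and>
           card L * (\<Delta> div d) * (k - r) \<le> Ord V E"
proof (cases "\<Delta> = 0")
  case True
  then show ?thesis
    by (intro exI[of _ "{}"]) (simp add: k_graph_def intersecting_def max_degree_at_most_def)
next
  case False
  define I where "I = L \<times> {..<\<Delta> div d}"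
  define e0 :: "'l \<times> nat \<Rightarrow> ('v + ('l \<times> nat) \<times> nat) set"
    where "e0 i = Inl ` pts (fst i) \<union> Inr ` ({i} \<times> {..<k - card (pts (fst i))})" for i
  define e where "e i = to_nat ` e0 i" for i
  define E where "E = e ` I"
  define V where "V = \<Union>E"
  have finI: "finite I" using ls by (simp add: I_def line_system_def)
  have l: "finite (pts (fst i))" "card (pts (fst i)) \<le> r" if "i \<in> I" for i
    using that ls by (auto simp: I_def line_system_def)
  have card_e: "finite (e i)" "card (e i) = k" if "i \<in> I" for i
  proof -
    have "card (e0 i) = card (pts (fst i)) + (k - card (pts (fst i)))"
      unfolding e0_def using l[OF that]
      by (subst card_Un_disjoint) (auto simp: card_image)
    then show "card (e i) = k" using l[OF that] \<open>r < k\<close> by (simp add: e_def card_image)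
    show "finite (e i)" using l[OF that] by (simp add: e_def e0_def)
  qed
  have meet: "e i \<inter> e j \<noteq> {}" if "i \<in> I" "j \<in> I" for i j
  proof -
    have "pts (fst i) \<inter> pts (fst j) \<noteq> {}" using that ls by (auto simp: I_def line_system_def)
    then show ?thesis by (auto simp: e_def e0_def)
  qed
  have deg: "degree E v \<le> \<Delta>" if vV: "v \<in> V" for v
  proof -
    obtain u :: "'v + ('l \<times> nat) \<times> nat" where u: "v = to_nat u" using vV by (auto simp: V_def E_def e_def)
    have inc: "incident_edges E v \<subseteq> e ` {i \<in> I. u \<in> e0 i}"
      by (auto simp: incident_edges_def E_def e_def u)
    have "degree E v \<le> card (e ` {i \<in> I. u \<in> e0 i})"
      unfolding degree_def by (rule card_mono) (use finI inc in auto)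
    also have "\<dots> \<le> card {i \<in> I. u \<in> e0 i}" by (rule card_image_le) (use finI in simp)
    also have "\<dots> \<le> \<Delta>"
    proof (cases u)
      case (Inl x)
      have "{i \<in> I. u \<in> e0 i} = {l \<in> L. x \<in> pts l} \<times> {..<\<Delta> div d}"
        by (auto simp: I_def e0_def Inl)
      then have "card {i \<in> I. u \<in> e0 i} \<le> d * (\<Delta> div d)"
        using ls by (simp add: card_cartesian_product line_system_def)
      also have "\<dots> \<le> \<Delta>" by simp
      finally show ?thesis .
    next
      case (Inr y)
      have "card {i \<in> I. u \<in> e0 i} \<le> card {fst y}"
        by (rule card_mono) (auto simp: e0_def Inr)
      then show ?thesis using False by simp
    qed
    finally show ?thesis .
  qed
  \<comment> \<open>A line has at most \<open>r\<close> points, so each copy has at least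
    \<open>k - r\<close> private vertices; only these are counted.\<close>
  define P :: "('v + ('l \<times> nat) \<times> nat) set" where "P = Inr ` (I \<times> {..<k - r})"
  have "card (to_nat ` P) \<le> card (non_isolated V E)"
  proof (rule card_mono)
    have "non_isolated V E \<subseteq> \<Union>(e ` I)" by (auto simp: non_isolated_def E_def)
    then show "finite (non_isolated V E)"
      by (rule finite_subset) (use finI card_e in auto)
    have "\<exists>i\<in>I. w \<in> e0 i" if "w \<in> P" for w
      using that by (force simp: P_def e0_def dest: l(2))
    then have "to_nat ` P \<subseteq> \<Union>E" by (fastforce simp: E_def e_def)
    then show "to_nat ` P \<subseteq> non_isolated V E"
      by (auto simp: non_isolated_def V_def)
  qed
  moreover have "card (to_nat ` P) = card L * (\<Delta> div d) * (k - r)"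
    by (simp add: P_def card_image I_def card_cartesian_product)
  ultimately have "card L * (\<Delta> div d) * (k - r) \<le> Ord V E" by (simp add: Ord_def)
  moreover have "k_graph k V E" using card_e by (auto simp: k_graph_def E_def V_def)
  moreover have "intersecting E" using meet by (auto simp: intersecting_def E_def)
  moreover have "max_degree_at_most V E \<Delta>"
    using deg finI by (auto simp: max_degree_at_most_def incident_edges_def E_def)
  ultimately show ?thesis by blast
qed

section \<open>Density of products of powers of two primes\<close>

text \<open>Starting from the largest \<open>q ^ J \<le> x\<close>, replacing \<open>q ^ v\<close> by \<open>p ^ u\<close> climbs towards \<open>x\<close> in
  steps of ratio at most \<open>1 + \<delta>\<close>.\<close>

lemma two_powers_dense_of_ratio:
  fixes p q u v :: nat and \<delta> :: real
  assumes "p > 1" "q > 1" and ratio: "real q ^ v < real p ^ u" "real p ^ u \<le> (1 + \<delta>) * real q ^ v"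
  shows "\<forall>\<^sub>F x :: real in at_top. \<exists>i j. real (p ^ i * q ^ j) \<le> x \<and> x \<le> (1 + \<delta>) * real (p ^ i * q ^ j)"
proof -
  define \<rho> where "\<rho> = real p ^ u / real q ^ v"
  have \<rho>: "\<rho> > 1" "\<rho> \<le> 1 + \<delta>" using assms by (auto simp: \<rho>_def field_simps)
  \<comment> \<open>\<open>M\<close> climbing steps outrun a factor \<open>q\<close>, so fewer than
    \<open>M\<close> are made; the threshold \<open>q ^ (v * M)\<close> for \<open>x\<close>
    provides enough factors \<open>q\<close> to trade.\<close>
  obtain M where M: "real q < \<rho> ^ M" using real_arch_pow[OF \<rho>(1)] by blast
  have "\<exists>i j. real (p ^ i * q ^ j) \<le> x \<and> x \<le> (1 + \<delta>) * real (p ^ i * q ^ j)"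
    if x: "x \<ge> real q ^ (v * M)" for x
  proof -
    obtain K where "x < real q ^ K" using real_arch_pow[of "real q" x] assms(2) by auto
    then have exK: "\<exists>K. x < real q ^ K" ..
    define J' where "J' = (LEAST K. x < real q ^ K)"
    have J': "x < real q ^ J'" unfolding J'_def by (rule LeastI_ex) (rule exK)
    have "real q ^ (v * M) < real q ^ J'" using x J' by simp
    then have lt: "v * M < J'" using assms(2) by simp
    then obtain J where J: "J' = Suc J" by (cases J') auto
    have Jx: "real q ^ J \<le> x"
      using not_less_Least[of J "\<lambda>K. x < real q ^ K"] J by (simp add: J'_def[symmetric])
    have top: "x < real q ^ J * \<rho> ^ M"
    proof -
      have "x < real q ^ J * real q" using J' J by (simp add: mult.commute)
      also have "\<dots> < real q ^ J * \<rho> ^ M" using M assms(2) by simp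
      finally show ?thesis .
    qed
    define s' where "s' = (LEAST s. x < real q ^ J * \<rho> ^ s)"
    have s': "x < real q ^ J * \<rho> ^ s'" unfolding s'_def by (rule LeastI[where P = "\<lambda>s. x < real q ^ J * \<rho> ^ s", OF top])
    have "s' \<le> M" unfolding s'_def by (rule Least_le[where P = "\<lambda>s. x < real q ^ J * \<rho> ^ s", OF top])
    moreover have "s' \<noteq> 0" using s' Jx by (intro notI) simp
    ultimately obtain s where s: "s' = Suc s" "s < M" by (cases s') auto
    \<comment> \<open>The step \<open>s\<close> is the last one not exceeding \<open>x\<close>;
      since the next one overshoots, a factor of at most \<rho> is missing.\<close>
    have sx: "real q ^ J * \<rho> ^ s \<le> x"
      using not_less_Least[of s "\<lambda>s. x < real q ^ J * \<rho> ^ s"] s by (simp add: s'_def[symmetric])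
    have "v * s \<le> v * M" using s by simp
    then have "v * s \<le> J" using lt J by linarith
    then have eq: "real q ^ J * \<rho> ^ s = real (p ^ (u * s) * q ^ (J - v * s))"
      using assms(2) power_diff[of "real q" "v * s" J]
      by (simp add: \<rho>_def power_divide flip: power_mult)
    have "x \<le> \<rho> * (real q ^ J * \<rho> ^ s)" using s' s by (simp add: mult_ac)
    also have "\<dots> \<le> (1 + \<delta>) * (real q ^ J * \<rho> ^ s)"
      using \<rho> by (intro mult_right_mono) auto
    finally show ?thesis using sx unfolding eq by blast
  qed
  then show ?thesis by (rule eventually_at_top_linorderI)
qed

text \<open>Dirichlet approximation of \<open>ln p / ln q\<close> with error below
  \<open>1 / N\<close> makes \<open>u * ln p\<close> and \<open>v * ln q\<close> differ by at most
  \<open>ln (1 + \<delta>)\<close>. Which power is larger stays open, hence the two symmetric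
  bounds.\<close>

lemma prime_powers_close_ratio:
  fixes p q :: nat and \<delta> :: real
  assumes "prime p" "prime q" "p \<noteq> q" "\<delta> > 0"
  obtains u v where "real p ^ u \<noteq> real q ^ v"
    "real p ^ u \<le> (1 + \<delta>) * real q ^ v" "real q ^ v \<le> (1 + \<delta>) * real p ^ u"
proof -
  have pq: "p > 1" "q > 1" using assms by (simp_all add: prime_gt_1_nat del: One_nat_def)
  define \<theta> where "\<theta> = ln p / ln q"
  have lnq: "ln q > 0" and lnp: "ln p > 0" using pq by auto
  have ld: "ln (1 + \<delta>) > 0" using assms by simp
  obtain N :: nat where N: "N > 0" "ln q / ln (1 + \<delta>) < N"
    using reals_Archimedean2[of "ln q / ln (1 + \<delta>)"] lnq ld
    by (metis divide_pos_pos less_trans of_nat_0_less_iff)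
  obtain h k where hk: "0 < k" "\<bar>of_int k * \<theta> - of_int h\<bar> < 1 / N"
    using Dirichlet_approx[OF N(1), of \<theta>] by metis
  \<comment> \<open>The error is below 1 and \<open>k * \<theta>\<close> is positive, so the integer
    \<open>h\<close> is nonnegative and can serve as an exponent.\<close>
  have "1 / real N \<le> 1" using N by simp
  moreover have "of_int k * \<theta> > 0" using hk lnq lnp by (simp add: \<theta>_def)
  ultimately have "of_int h > (-1 :: real)" using hk(2) by linarith
  then have h: "h \<ge> 0" by linarith
  define u v where "u = nat k" and "v = nat h"
  have uv: "u > 0" "real_of_int k = u" "real_of_int h = v" using hk h by (auto simp: u_def v_def)
  have "u * ln p - v * ln q = (u * \<theta> - v) * ln q"
    using lnq by (simp add: \<theta>_def algebra_simps)
  then have "\<bar>u * ln p - v * ln q\<bar> = \<bar>u * \<theta> - v\<bar> * ln q"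
    using lnq by (simp add: abs_mult)
  also have "\<dots> \<le> (1 / N) * ln q"
    using hk(2) uv lnq by (intro mult_right_mono) auto
  also have "\<dots> \<le> ln (1 + \<delta>)" using N ld by (simp add: field_simps)
  finally have close: "\<bar>u * ln p - v * ln q\<bar> \<le> ln (1 + \<delta>)" .
  have lns: "ln (real p ^ u) = u * ln p" "ln (real q ^ v) = v * ln q"
    "ln ((1 + \<delta>) * real q ^ v) = ln (1 + \<delta>) + v * ln q"
    "ln ((1 + \<delta>) * real p ^ u) = ln (1 + \<delta>) + u * ln p"
    using pq assms(4) by (simp_all add: ln_realpow ln_mult)
  show thesis
  proof (rule that)
    show "real p ^ u \<noteq> real q ^ v"
    proof
      assume "real p ^ u = real q ^ v"
      then have "p ^ u = q ^ v" by (metis of_nat_eq_iff of_nat_power)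
      then have "p dvd q ^ v" using uv(1) by (metis dvd_power)
      then have "p dvd q" using assms(1) prime_dvd_power by blast
      then show False using assms by (simp add: primes_dvd_imp_eq)
    qed
    have "ln (real p ^ u) \<le> ln ((1 + \<delta>) * real q ^ v)" using close lns by linarith
    then show "real p ^ u \<le> (1 + \<delta>) * real q ^ v" using pq assms(4) by (subst (asm) ln_le_cancel_iff) auto
    have "ln (real q ^ v) \<le> ln ((1 + \<delta>) * real p ^ u)" using close lns by linarith
    then show "real q ^ v \<le> (1 + \<delta>) * real p ^ u" using pq assms(4) by (subst (asm) ln_le_cancel_iff) auto
  qed
qed

lemma two_prime_powers_dense:
  fixes p q :: nat and \<delta> :: real
  assumes "prime p" "prime q" "p \<noteq> q" "\<delta> > 0"
  shows "\<forall>\<^sub>F x :: real in at_top. \<exists>i j. real (p ^ i * q ^ j) \<le> x \<and> x \<le> (1 + \<delta>) * real (p ^ i * q ^ j)"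
proof -
  have pq: "p > 1" "q > 1" using assms by (simp_all add: prime_gt_1_nat del: One_nat_def)
  obtain u v where uv: "real p ^ u \<noteq> real q ^ v"
    "real p ^ u \<le> (1 + \<delta>) * real q ^ v" "real q ^ v \<le> (1 + \<delta>) * real p ^ u"
    using prime_powers_close_ratio[OF assms] by metis
  show ?thesis
  proof (cases "real q ^ v < real p ^ u")
    case True
    then show ?thesis using two_powers_dense_of_ratio pq uv by blast
  next
    case False
    then have "real p ^ u < real q ^ v" using uv by simp
    from two_powers_dense_of_ratio[OF pq(2,1) this uv(3)] show ?thesis
      by (rule eventually_mono) (metis mult.commute)
  qed
qed


section \<open>Choice of parameters\<close>

text \<open>With \<open>n = p ^ i * q ^ j\<close> slightly below k/2 there are n^2 lines, about
  \<Delta>/n copies of each and at least k/2 private vertices per copy: about n \<Delta> k / 2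
  vertices. The term \<open>C k\<close> may be arbitrary because \<Delta> grows with
  \<open>k\<close> fixed.\<close>

lemma Ord_asymptotic_lower_bound:
  fixes \<epsilon> :: real and C :: "nat \<Rightarrow> real"
  assumes "\<epsilon> > 0"
  shows "\<forall>\<^sub>F k in sequentially. \<forall>\<^sub>F \<Delta> in sequentially.
      \<exists>(V :: nat set) E. k_graph k V E \<and> intersecting E \<and> max_degree_at_most V E \<Delta> \<and>
        real (Ord V E) \<ge> (1 - \<epsilon>) * (1/4 * real k ^ 2 * real \<Delta> + C k)"
proof -
  define \<delta> where "\<delta> = \<epsilon> / 4"
  have \<delta>: "\<delta> > 0" using assms by (simp add: \<delta>_def)
  \<comment> \<open>One factor \<open>1 + \<delta>\<close> is lost to the points at infinity, the
    other to the gaps between the numbers \<open>p ^ i * q ^ j\<close>.\<close>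
  define c where "c = 1 / (1 + \<delta>)\<^sup>2"
  have c: "c > 0" "c - (1 - \<epsilon>) > 0"
  proof -
    show "c > 0" using \<delta> by (simp add: c_def)
    have "(1 - 2 * \<delta>) * (1 + \<delta>)\<^sup>2 = 1 - 3 * \<delta>\<^sup>2 - 2 * \<delta> ^ 3"
      by (simp add: power2_eq_square power3_eq_cube algebra_simps)
    also have "\<dots> \<le> 1" using zero_le_power[of \<delta> 2] zero_le_power[of \<delta> 3] \<delta> by linarith
    finally have "1 - 2 * \<delta> \<le> c" using \<delta> by (simp add: c_def field_simps)
    then show "c - (1 - \<epsilon>) > 0" using \<delta> by (simp add: \<delta>_def)
  qed
  \<comment> \<open>Points at infinity enlarge lines by factors of at most \<open>1 + 1 / p\<close>
    and \<open>1 + 1 / q\<close>; for primes above \<open>3 / \<delta>\<close> their product is at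
    most \<open>1 + \<delta>\<close>.\<close>
  obtain M :: nat where M: "M > 3 / \<delta>" using reals_Archimedean2 by blast
  obtain p where p: "prime p" "p > M" using bigger_prime by blast
  obtain q where q: "prime q" "q > p" using bigger_prime by blast
  have pq0: "p > 0" "q > 0" using p q by (auto simp: prime_gt_0_nat)
  have slack: "(1 + 1 / p) * (1 + 1 / q) \<le> 1 + \<delta>"
  proof -
    have "1 / q \<le> 1 / real p" using pq0 q by (simp add: frac_le)
    then have "(1 + 1 / p) * (1 + 1 / q) \<le> (1 + 1 / p) * (1 + 1 / real p)"
      by (intro mult_left_mono) auto
    also have "\<dots> = 1 + 2 / p + 1 / p * (1 / p)" by (simp add: algebra_simps)
    also have "1 / p * (1 / p) \<le> 1 / real p * 1" using pq0 by (intro mult_left_mono) auto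
    also have "1 + 2 / p + 1 / real p * 1 = 1 + 3 / p" by simp
    also have "3 / real p \<le> \<delta>"
    proof -
      have "3 / \<delta> < p" using M p by linarith
      then show ?thesis using \<delta> pq0 by (simp add: field_simps)
    qed
    finally show ?thesis by simp
  qed
  have "filterlim (\<lambda>k. 1 / (2 * (1 + \<delta>)) * real k) at_top sequentially"
    using \<delta> by (intro filterlim_tendsto_pos_mult_at_top[OF tendsto_const] filterlim_real_sequentially) auto
  then have lim: "filterlim (\<lambda>k. real k / (2 * (1 + \<delta>))) at_top sequentially" by simp
  have "\<forall>\<^sub>F x :: real in at_top.
      \<exists>i j. real (p ^ i * q ^ j) \<le> x \<and> x \<le> (1 + \<delta>) * real (p ^ i * q ^ j)"
    by (rule two_prime_powers_dense) (use p q \<delta> in auto)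
  from eventually_compose_filterlim[OF this lim] have "\<forall>\<^sub>F k in sequentially. \<exists>i j. real (p ^ i * q ^ j) \<le> real k / (2 * (1 + \<delta>)) \<and>
      real k / (2 * (1 + \<delta>)) \<le> (1 + \<delta>) * real (p ^ i * q ^ j)"
    .
  then show ?thesis
    using eventually_gt_at_top[of 0]
  proof eventually_elim
    case (elim k)
    then obtain i j where ij: "real (p ^ i * q ^ j) \<le> real k / (2 * (1 + \<delta>))"
      "real k / (2 * (1 + \<delta>)) \<le> (1 + \<delta>) * real (p ^ i * q ^ j)" by blast
    define n where "n = p ^ i * q ^ j"
    define r where "r = (p ^ i + p ^ i div p) * (q ^ j + q ^ j div q)"
    have n: "n > 0" using pq0 by (simp add: n_def)
    have upper: "real n * (1 + \<delta>) \<le> k / 2"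
      using ij(1) \<delta> by (simp add: n_def field_simps)
    have "c * k / 2 = k / (2 * (1 + \<delta>)) / (1 + \<delta>)" by (simp add: c_def power2_eq_square)
    also have "\<dots> \<le> n" using ij(2) \<delta> by (simp add: n_def pos_divide_le_eq mult_ac)
    finally have lower: "c * k / 2 \<le> n" .
    have "real r \<le> (real (p ^ i) + real (p ^ i) / p) * (real (q ^ j) + real (q ^ j) / q)"
      unfolding r_def of_nat_mult of_nat_add
      by (intro mult_mono add_mono order.refl of_nat_div_le_of_nat) auto
    also have "\<dots> = n * ((1 + 1 / p) * (1 + 1 / q))" by (simp add: n_def field_simps)
    also have "\<dots> \<le> n * (1 + \<delta>)" using slack by (intro mult_left_mono) auto
    finally have r: "real r \<le> k / 2" using upper by simp
    then have "r < k" using elim by simp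
    let ?L = "\<lambda>m. {0..<int m} \<times> {0..<int m}"
    let ?LL = "?L (p ^ i) \<times> ?L (q ^ j)"
    have card: "card ?LL = n * n" by (simp add: card_cartesian_product n_def nat_power_eq)
    have ls: "line_system ?LL (\<lambda>(l, l'). ring_line p (p ^ i) l \<times> ring_line q (q ^ j) l') r n"
      unfolding r_def n_def using line_system_product[OF ring_line_system ring_line_system] p q by simp
    have *: "\<exists>(V :: nat set) E. k_graph k V E \<and> intersecting E \<and> max_degree_at_most V E \<Delta> \<and>
        n * n * (\<Delta> div n) * (k - r) \<le> Ord V E" for \<Delta>
      using blow_up_line_system[OF ls \<open>r < k\<close> n, of \<Delta>] unfolding card .
    \<comment> \<open>After \<open>n * (\<Delta> div n)\<close> is bounded below by
      \<open>\<Delta> - n\<close>, the goal is linear in \<Delta> with slope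
      \<open>(c - (1 - \<epsilon>)) * k\<^sup>2 / 4 > 0\<close>; \<open>D\<close> is where equality
      holds.\<close>
    define D where "D = (c * n * k\<^sup>2 / 4 + (1 - \<epsilon>) * C k) / ((c - (1 - \<epsilon>)) * k\<^sup>2 / 4)"
    have "\<forall>\<^sub>F \<Delta> in sequentially. real \<Delta> \<ge> D"
      using filterlim_real_sequentially by (simp add: filterlim_at_top)
    then show ?case
      using eventually_ge_at_top[of n]
    proof eventually_elim
      case (elim \<Delta>)
      have "(c - (1 - \<epsilon>)) * k\<^sup>2 / 4 > 0" using c \<open>0 < k\<close> by simp
      then have "c * n * k\<^sup>2 / 4 + (1 - \<epsilon>) * C k \<le> \<Delta> * ((c - (1 - \<epsilon>)) * k\<^sup>2 / 4)"
        using elim(1) unfolding D_def by (simp only: pos_divide_le_eq)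
      moreover have "c * k / 2 * (\<Delta> - real n) * (k / 2) - (1 - \<epsilon>) * (1/4 * real k ^ 2 * real \<Delta> + C k)
          = \<Delta> * ((c - (1 - \<epsilon>)) * k\<^sup>2 / 4) - (c * n * k\<^sup>2 / 4 + (1 - \<epsilon>) * C k)"
        by (simp add: field_simps power2_eq_square)
      ultimately have "(1 - \<epsilon>) * (1/4 * real k ^ 2 * real \<Delta> + C k) \<le> c * k / 2 * (\<Delta> - real n) * (k / 2)"
        by linarith
      also have "\<dots> \<le> n * (n * real (\<Delta> div n)) * real (k - r)"
      proof (intro mult_mono lower)
        have "\<Delta> \<le> n * (\<Delta> div n) + n"
          using n by (metis add_left_mono less_imp_le mod_less_divisor mult_div_mod_eq)
        then have "real \<Delta> \<le> real (n * (\<Delta> div n) + n)" by (rule of_nat_mono)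
        then show "\<Delta> - real n \<le> n * real (\<Delta> div n)" by simp
        show "k / 2 \<le> real (k - r)" using r \<open>r < k\<close> by (simp add: of_nat_diff)
      \<comment> \<open>Here \<open>\<Delta> \<ge> n\<close> makes \<open>\<Delta> - n\<close>
        nonnegative, as multiplying the bounds requires.\<close>
      qed (use elim(2) in auto)
      also have "\<dots> = real (n * n * (\<Delta> div n) * (k - r))" by (simp only: of_nat_mult mult.assoc)
      finally have "(1 - \<epsilon>) * (1/4 * real k ^ 2 * real \<Delta> + C k) \<le> real (n * n * (\<Delta> div n) * (k - r))" .
      then show ?case using *[of \<Delta>] by (meson of_nat_mono order.trans)
    qed
  qed
qed

theorem theorem1p3:
  "(\<forall>k \<Delta> (V :: 'a set) E.
      k > 0 \<longrightarrow> \<Delta> > 0 \<longrightarrow> k_graph k V E \<longrightarrow> intersecting E \<longrightarrow> max_degree_at_most V E \<Delta> \<longrightarrow>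
      finite (non_isolated V E) \<and>
      real (Ord V E) \<le> 1/4 * real k ^ 2 * real \<Delta> + 3/2 * real ((2 * k - 2) choose (k - 1))) \<and>
   (\<forall>\<epsilon>>0. \<forall>\<^sub>F k in sequentially. \<forall>\<^sub>F \<Delta> in sequentially.
      \<exists>(V :: nat set) E. k_graph k V E \<and> intersecting E \<and> max_degree_at_most V E \<Delta> \<and>
        real (Ord V E) \<ge> (1 - \<epsilon>) * (1/4 * real k ^ 2 * real \<Delta> + 3/2 * real ((2 * k - 2) choose (k - 1))))"
proof (intro conjI allI impI)
  fix k \<Delta> :: nat and V :: "'a set" and E
  assume H: "k > 0" "\<Delta> > 0" "k_graph k V E" "intersecting E" "max_degree_at_most V E \<Delta>"
  show "finite (non_isolated V E)" by (rule Ord_upper_bound(1)[OF H])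
  have "real k \<le> real ((2 * k - 2) choose (k - 1))"
    using central_binomial_ge[OF H(1)] by (rule of_nat_mono)
  moreover have "real k \<ge> 1" using H(1) by simp
  ultimately show "real (Ord V E) \<le> 1/4 * real k ^ 2 * real \<Delta> + 3/2 * real ((2 * k - 2) choose (k - 1))"
    using Ord_upper_bound(2)[OF H] by linarith
next
  fix \<epsilon> :: real
  assume "\<epsilon> > 0"
  then show "\<forall>\<^sub>F k in sequentially. \<forall>\<^sub>F \<Delta> in sequentially.
      \<exists>(V :: nat set) E. k_graph k V E \<and> intersecting E \<and> max_degree_at_most V E \<Delta> \<and>
        real (Ord V E) \<ge> (1 - \<epsilon>) * (1/4 * real k ^ 2 * real \<Delta> + 3/2 * real ((2 * k - 2) choose (k - 1)))"
    by (rule Ord_asymptotic_lower_bound)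
qed

end
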